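(* Let $f$ be an analytic function in $\mathbb{D}$. If $f$ is unbounded, then $\lambda_*(f)\le\lambda_M(f)+1$. If $\sigma_M(f)>0$, then $\lambda_M(f)+\frac{\lambda_M(f)}{\sigma_M(f)}\le\lambda_*(f)$.
   Context: $\mathbb{D}=\{z\in\mathbb{C}:|z|<1\}$, $M(r,f)=\max_{|z|=r}|f(z)|$, and $\log^+x=\max\{\log x,0\}$ (with $\log^+0=0$). For $f$ analytic in $\mathbb{D}$, $$\sigma_M(f)=\limsup_{r\to1^-}\frac{\log^+\log^+M(r,f)}{\log\frac1{1-r}},\qquad \lambda_M(f)=\liminf_{r\to1^-}\frac{\log^+\log^+M(r,f)}{\log\frac1{1-r}},$$ $$\lambda_*(f)=\liminf_{r\to1^-}\frac{\log^+K(r,f)}{\log\frac1{1-r}},\qquad K(r,f)=r\,(\log M(r,f))'_+,$$ where $(\cdot)'_+$ denotes the right derivative with respect to $r$. These quantities take values in $[0,\infty]$. Conventions: $\lambda_M/\sigma_M=0$ if $\sigma_M=\infty$ and $\lambda_M<\infty$; if $\lambda_M(f)=\infty$, the left side of the second inequality is read as $\infty$. *)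

theory Defs
  imports "HOL-Complex_Analysis.Complex_Analysis"
begin

text \<open>
  Throughout, \<open>f\<close> is meant to be analytic in the open unit disc. Then \<open>|f|\<close> is continuous on each
  circle of radius \<open>0 \<le> r < 1\<close>, so the supremum below is finite and attained.
\<close>

definition max_modulus :: "(complex \<Rightarrow> complex) \<Rightarrow> real \<Rightarrow> real" where
  "max_modulus f r = (SUP z\<in>sphere 0 r. norm (f z))"

definition log_plus :: "real \<Rightarrow> real" where
  "log_plus x = (if x > 0 then max (ln x) 0 else 0)"

text \<open>
  For \<open>f\<close> not identically zero, \<open>ln (max_modulus f r)\<close> is a convex function of \<open>ln r\<close>
  (Hadamard's three circles theorem). Hence it has a finite right derivative at every
  \<open>0 < r < 1\<close>, and the underspecified case of \<^const>\<open>vector_derivative\<close> does not occur there.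
\<close>

definition K_char :: "(complex \<Rightarrow> complex) \<Rightarrow> real \<Rightarrow> real" where
  "K_char f r = r * vector_derivative (\<lambda>t. ln (max_modulus f t)) (at_right r)"

definition sigma_M :: "(complex \<Rightarrow> complex) \<Rightarrow> ereal" where
  "sigma_M f =
     Limsup (at_left 1) (\<lambda>r. ereal (log_plus (log_plus (max_modulus f r)) / ln (1 / (1 - r))))"

definition lambda_M :: "(complex \<Rightarrow> complex) \<Rightarrow> ereal" where
  "lambda_M f =
     Liminf (at_left 1) (\<lambda>r. ereal (log_plus (log_plus (max_modulus f r)) / ln (1 / (1 - r))))"

definition lambda_star :: "(complex \<Rightarrow> complex) \<Rightarrow> ereal" where
  "lambda_star f =
     Liminf (at_left 1) (\<lambda>r. ereal (log_plus (K_char f r) / ln (1 / (1 - r))))"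

text \<open>
  Quotients \<open>lambda_M f / sigma_M f\<close> are taken in \<^typ>\<open>ereal\<close>, where \<open>x / \<infinity> = x * 0 = 0\<close> for all
  \<open>x\<close>, including \<open>x = \<infinity>\<close>. So \<open>lambda_M f + lambda_M f / sigma_M f\<close> equals \<open>lambda_M f\<close> when
  \<open>sigma_M f = \<infinity>\<close>, and in particular equals \<open>\<infinity>\<close> when \<open>lambda_M f = \<infinity>\<close>:
\<close>

lemma ereal_add_divide_infinity: "x + x / \<infinity> = (x :: ereal)"
  by (cases x) auto

end

theory Submission
  imports Defs "HOL-Real_Asymp.Real_Asymp"
begin

text \<open>
  By Hadamard's three circles theorem \<open>ln M(r)\<close> is convex in \<open>ln r\<close>, so \<open>K(r)\<close> is the slope of a
  supporting line: \<open>ln M(R) \<ge> ln M(r) + K(r) (ln R - ln r)\<close> for all \<open>r, R\<close>. With \<open>1 - r = 2 (1 - R)\<close>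
  a lower bound for \<open>K(r)\<close> yields one for \<open>ln M(R)\<close> that loses a factor \<open>1 - R\<close>; this is the first
  inequality. For the second, let \<open>a < \<lambda>\<^sub>M\<close> and \<open>s > \<sigma>\<^sub>M\<close>, and take the line at \<open>r\<close> and the point \<open>\<rho>\<close>
  with \<open>1 - \<rho>\<close> comparable to \<open>(1 - r) powr (a / s)\<close>: then \<open>ln M(\<rho>)\<close> is at most half of \<open>ln M(r)\<close>,
  so \<open>K(r)\<close> is at least a constant times \<open>(1 - r) powr (- a) / (1 - \<rho>)\<close>.
\<close>

section \<open>Right derivatives of convex functions\<close>

text \<open>Slopes of chords from \<open>x\<close> to the right decrease as the endpoint approaches
  \<open>x\<close>, so they converge to their infimum. That infimum is also the slope of a
  supporting line, so a single \<open>D\<close> serves both conclusions.\<close>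

lemma convex_on_has_right_derivative:
  fixes \<phi> :: "real \<Rightarrow> real"
  assumes conv: "convex_on I \<phi>" and x: "x \<in> interior I"
  obtains D where "(\<phi> has_real_derivative D) (at_right x)"
    and "\<And>y. y \<in> I \<Longrightarrow> \<phi> x + D * (y - x) \<le> \<phi> y"
proof -
  define D where "D = Inf ((\<lambda>t. (\<phi> x - \<phi> t) / (x - t)) ` ({x<..} \<inter> I))"
  have tangent: "\<phi> x + D * (y - x) \<le> \<phi> y" if "y \<in> I" for y
    using convex_le_Inf_differential[OF conv x that] unfolding D_def by simp
  obtain e where e: "e > 0" "ball x e \<subseteq> I"
    using x by (meson mem_interior)
  have xI: "x \<in> I" using x interior_subset by blast
  have near: "\<forall>\<^sub>F y in at_right x. y \<in> {x<..<x + e}"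
    using e by (intro eventually_at_right_real) auto
  have inI: "y \<in> I" if "y \<in> {x<..<x + e}" for y
    using that e by (auto simp: dist_real_def subset_iff)
  have "((\<lambda>y. (\<phi> y - \<phi> x) / (y - x)) \<longlongrightarrow> D) (at_right x)"
  proof (rule order_tendstoI)
    fix a assume "a < D"
    show "\<forall>\<^sub>F y in at_right x. a < (\<phi> y - \<phi> x) / (y - x)"
      using near
    proof eventually_elim
      case (elim y)
      have "D \<le> (\<phi> y - \<phi> x) / (y - x)"
        using tangent[OF inI[OF elim]] elim by (simp add: field_simps)
      with \<open>a < D\<close> show ?case by simp
    qed
  next
    fix a assume "D < a"
    moreover have "x + e / 2 \<in> {x<..} \<inter> I"
      using e inI[of "x + e / 2"] by auto
    \<comment> \<open>One chord with slope below \<open>a\<close> suffices: all shorter chords to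
      the right of \<open>x\<close> have at most its slope.\<close>
    ultimately obtain t where t: "t \<in> I" "x < t" "(\<phi> x - \<phi> t) / (x - t) < a"
      unfolding D_def using cInf_lessD[of "(\<lambda>t. (\<phi> x - \<phi> t) / (x - t)) ` ({x<..} \<inter> I)" a]
      by blast
    have "\<forall>\<^sub>F y in at_right x. y \<in> {x<..<t}"
      using t by (intro eventually_at_right_real) auto
    then show "\<forall>\<^sub>F y in at_right x. (\<phi> y - \<phi> x) / (y - x) < a"
    proof eventually_elim
      case (elim y)
      have "(\<phi> x - \<phi> y) / (x - y) \<le> (\<phi> x - \<phi> t) / (x - t)"
        using elim t by (intro convex_on_slope_le[OF conv xI]) auto
      moreover have "(\<phi> x - \<phi> y) / (x - y) = (\<phi> y - \<phi> x) / (y - x)"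
        by (metis minus_diff_eq minus_divide_divide)
      ultimately show ?case using t by simp
    qed
  qed
  then have "(\<phi> has_real_derivative D) (at_right x)"
    by (simp add: has_field_derivative_iff)
  with tangent show thesis using that by blast
qed

section \<open>The maximum modulus and Hadamard's three circles theorem\<close>

lemma
  assumes "f holomorphic_on ball 0 1" "0 \<le> r" "r < 1"
  shows norm_le_max_modulus: "norm z = r \<Longrightarrow> norm (f z) \<le> max_modulus f r"
    and max_modulus_attained: "\<exists>z. norm z = r \<and> norm (f z) = max_modulus f r"
proof -
  have "sphere (0::complex) r \<subseteq> ball 0 1" using assms by auto
  then have cont: "continuous_on (sphere 0 r) (\<lambda>z. norm (f z))"
    using assms(1)
    by (intro continuous_on_norm) (metis continuous_on_subset holomorphic_on_imp_continuous_on)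
  have "of_real r \<in> sphere (0::complex) r" using assms by simp
  then obtain z where z: "z \<in> sphere 0 r" "\<And>w. w \<in> sphere 0 r \<Longrightarrow> norm (f w) \<le> norm (f z)"
    using continuous_attains_sup[OF compact_sphere _ cont] by blast
  have eq: "max_modulus f r = norm (f z)"
    unfolding max_modulus_def using z by (intro cSup_eq_maximum) auto
  then show "norm w = r \<Longrightarrow> norm (f w) \<le> max_modulus f r" for w
    using z by simp
  show "\<exists>z. norm z = r \<and> norm (f z) = max_modulus f r"
    using eq z by auto
qed

lemma norm_le_max_modulus_cball:
  assumes hol: "f holomorphic_on ball 0 1" and "r < 1" "norm z \<le> r"
  shows "norm (f z) \<le> max_modulus f r"
proof (rule maximum_modulus_frontier[where f = f and S = "cball 0 r"])
  have "0 \<le> r" using assms norm_ge_zero order_trans by blast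
  have sub: "cball (0::complex) r \<subseteq> ball 0 1" using assms by auto
  show "f holomorphic_on interior (cball 0 r)"
    using sub interior_subset by (intro holomorphic_on_subset[OF hol]) (rule order_trans)
  show "continuous_on (closure (cball 0 r)) f"
    using continuous_on_subset[OF holomorphic_on_imp_continuous_on[OF hol] sub] by simp
  show "norm (f w) \<le> max_modulus f r" if "w \<in> frontier (cball 0 r)" for w
    using that norm_le_max_modulus[OF hol \<open>0 \<le> r\<close> \<open>r < 1\<close>] by (auto simp: frontier_cball)
qed (use assms in auto)

lemma max_modulus_mono:
  assumes hol: "f holomorphic_on ball 0 1" and "0 \<le> r" "r \<le> s" "s < 1"
  shows "max_modulus f r \<le> max_modulus f s"
proof -
  obtain z where "norm z = r" "norm (f z) = max_modulus f r"
    using max_modulus_attained[OF hol, of r] assms by auto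
  then show ?thesis using norm_le_max_modulus_cball[OF hol, of s z] assms by simp
qed

text \<open>If the maximum vanished, \<open>f\<close> would vanish on \<open>ball 0 r\<close> by the
  maximum principle, and then on the whole disc by the identity theorem. Positivity makes the values
  of \<open>ln (max_modulus f r)\<close> genuine logarithms.\<close>

lemma max_modulus_pos:
  assumes hol: "f holomorphic_on ball 0 1" and nz: "\<exists>z\<in>ball 0 1. f z \<noteq> 0"
    and r: "0 < r" "r < 1"
  shows "0 < max_modulus f r"
proof (rule ccontr)
  assume "\<not> 0 < max_modulus f r"
  then have "f z = 0" if "z \<in> ball 0 r" for z
    using norm_le_max_modulus_cball[OF hol r(2), of z] that
    by (smt (verit) dist_0_norm mem_ball norm_le_zero_iff)
  moreover have "(0::complex) islimpt ball 0 r"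
    using r by (simp add: islimpt_ball)
  ultimately have "f z = 0" if "z \<in> ball 0 1" for z
    using analytic_continuation[OF hol open_ball connected_ball, of "ball 0 r" 0 z] that r
    by (auto simp: subset_ball)
  then show False using nz by blast
qed

text \<open>Multiplying by \<open>exp (a * w)\<close> after the substitution \<open>z = exp w\<close> gives a single-valued
  substitute for \<open>z powr a * f z\<close>; its modulus is \<open>2\<pi>\<i>\<close>-periodic, so it attains its maximum on
  a vertical strip.\<close>

lemma max_modulus_weighted_le:
  assumes hol: "f holomorphic_on ball 0 1" and xy: "x < z" "z < y" "y < 0"
  shows "exp (a * z) * max_modulus f (exp z)
    \<le> max (exp (a * x) * max_modulus f (exp x)) (exp (a * y) * max_modulus f (exp y))"
proof -
  define G where "G w = exp (of_real a * w) * f (exp w)" for w :: complex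
  define H where "H = {w::complex. Re w < 0}"
  have holG: "G holomorphic_on H"
  proof -
    have "exp ` H \<subseteq> ball 0 1" by (auto simp: H_def)
    then have "(f \<circ> exp) holomorphic_on H"
      by (intro holomorphic_on_compose holomorphic_on_exp) (auto intro: holomorphic_on_subset[OF hol])
    then show ?thesis unfolding G_def o_def by (intro holomorphic_intros)
  qed
  have normG: "norm (G w) = exp (a * Re w) * norm (f (exp w))" for w
    by (simp add: G_def norm_mult)
  have G_le: "norm (G w) \<le> exp (a * Re w) * max_modulus f (exp (Re w))" if "Re w < 0" for w
    using that norm_le_max_modulus[OF hol, of "exp (Re w)" "exp w"] by (simp add: normG)
  have attained: "\<exists>w. Re w = t \<and> 0 \<le> Im w \<and> Im w \<le> 2 * pi \<and>
      norm (G w) = exp (a * t) * max_modulus f (exp t)" if "t < 0" for t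
  proof -
    obtain v where v: "norm v = exp t" "norm (f v) = max_modulus f (exp t)"
      using max_modulus_attained[OF hol, of "exp t"] \<open>t < 0\<close>
      unfolding exp_less_one_iff by force
    \<comment> \<open>This is the logarithm of \<open>v\<close> with imaginary part in
      \<open>[0, 2 * pi)\<close>, so one compact rectangle sees the maximum on every vertical
      line.\<close>
    define w where "w = Complex t (Arg2pi v)"
    have "exp w = of_real (norm v) * exp (\<i> * of_real (Arg2pi v))"
      unfolding w_def Complex_eq exp_add v(1) by (simp add: exp_of_real)
    also have "\<dots> = v"
      using Arg2pi[of v] unfolding is_Arg_def by metis
    finally have "norm (G w) = exp (a * Re w) * max_modulus f (exp t)"
      by (simp add: normG v(2))
    moreover have "Re w = t" "0 \<le> Im w" "Im w \<le> 2 * pi"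
      using Arg2pi[of v] by (auto simp: w_def)
    ultimately show ?thesis by blast
  qed
  define Q where "Q = cbox (Complex x 0) (Complex y (2 * pi))"
  have Q: "w \<in> Q \<longleftrightarrow> x \<le> Re w \<and> Re w \<le> y \<and> 0 \<le> Im w \<and> Im w \<le> 2 * pi" for w
    by (auto simp: Q_def in_cbox_complex_iff)
  have "Q \<subseteq> H" using xy by (auto simp: Q H_def)
  then have "continuous_on Q (\<lambda>w. norm (G w))"
    using continuous_on_subset[OF holomorphic_on_imp_continuous_on[OF holG]]
    by (intro continuous_on_norm)
  moreover have "Complex x 0 \<in> Q" using xy by (simp add: Q)
  ultimately obtain w0 where w0: "w0 \<in> Q" "\<And>w. w \<in> Q \<Longrightarrow> norm (G w) \<le> norm (G w0)"
    using continuous_attains_sup[of Q] unfolding Q_def by (metis compact_cbox empty_iff)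
  have le_w0: "exp (a * t) * max_modulus f (exp t) \<le> norm (G w0)" if t: "x \<le> t" "t \<le> y" for t
  proof -
    obtain w where "Re w = t" "0 \<le> Im w" "Im w \<le> 2 * pi"
        "norm (G w) = exp (a * t) * max_modulus f (exp t)"
      using attained[of t] t xy by auto
    with w0(2)[of w] t show ?thesis by (simp add: Q)
  qed
  consider "Re w0 = x" | "Re w0 = y" | "x < Re w0" "Re w0 < y"
    using w0(1) by (fastforce simp: Q)
  then show ?thesis
  proof cases
    case 3
    \<comment> \<open>\<open>U\<close> is the full open strip because \<open>w0\<close> may lie on a
      horizontal edge of \<open>Q\<close>. By periodicity, encoded in \<open>le_w0\<close>, the
      maximum over \<open>Q\<close> bounds \<open>G\<close> on all of \<open>U\<close>.\<close>
    define U where "U = {w. x < Re w} \<inter> {w. Re w < y}"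
    have "G constant_on H"
    proof (rule maximum_modulus_principle[OF holG])
      show "open H" "open U"
        by (auto simp: H_def U_def open_halfspace_Re_lt open_halfspace_Re_gt intro!: open_Int)
      show "connected H"
        unfolding H_def by (intro convex_connected convex_halfspace_Re_lt)
      show "U \<subseteq> H" "w0 \<in> U" using xy 3 by (auto simp: U_def H_def)
      show "norm (G w) \<le> norm (G w0)" if "w \<in> U" for w
      proof -
        have "norm (G w) \<le> exp (a * Re w) * max_modulus f (exp (Re w))"
          using that xy by (intro G_le) (auto simp: U_def)
        also have "\<dots> \<le> norm (G w0)"
          using that by (intro le_w0) (auto simp: U_def)
        finally show ?thesis .
      qed
    qed
    then have "G w0 = G (of_real x)"
      using 3 xy unfolding constant_on_def H_def by auto
    then have "norm (G w0) \<le> exp (a * x) * max_modulus f (exp x)"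
      using G_le[of "of_real x"] xy by simp
    then show ?thesis using le_w0[of z] xy by simp
  qed (use le_w0[of z] G_le[of w0] xy in auto)
qed

lemma hadamard_three_circles:
  assumes hol: "f holomorphic_on ball 0 1" and nz: "\<exists>z\<in>ball 0 1. f z \<noteq> 0"
  shows "convex_on {..<0} (\<lambda>x. ln (max_modulus f (exp x)))"
proof (rule convex_on_linorderI)
  fix t x y :: real
  assume t: "0 < t" "t < 1" and xy: "x \<in> {..<0}" "y \<in> {..<0}" "x < y"
  define \<phi> where "\<phi> u = ln (max_modulus f (exp u))" for u
  define z where "z = (1 - t) * x + t * y"
  have z: "x < z" "z < y"
  proof -
    have "z = x + t * (y - x)" "z = y - (1 - t) * (y - x)"
      by (simp_all add: z_def algebra_simps)
    moreover have "0 < t * (y - x)" "0 < (1 - t) * (y - x)"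
      using t xy by simp_all
    ultimately show "x < z" "z < y" by linarith+
  qed
  \<comment> \<open>Minus the slope of the chord: adding \<open>a * u\<close> levels the values at
    \<open>x\<close> and \<open>y\<close>, so that the maximum of the two becomes their convex
    combination.\<close>
  define a where "a = - (\<phi> y - \<phi> x) / (y - x)"
  have balance: "a * x + \<phi> x = a * y + \<phi> y"
    using xy by (simp add: a_def field_simps)
  have eq: "exp (a * u) * max_modulus f (exp u) = exp (a * u + \<phi> u)" if "u < 0" for u
    using max_modulus_pos[OF hol nz, of "exp u"] that by (simp add: \<phi>_def exp_add)
  have "exp (a * z + \<phi> z) \<le> max (exp (a * x + \<phi> x)) (exp (a * y + \<phi> y))"
    using max_modulus_weighted_le[OF hol z, of a] xy z by (simp add: eq)
  then have "a * z + \<phi> z \<le> a * x + \<phi> x"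
    using balance by simp
  also have "\<dots> = (1 - t) * (a * x + \<phi> x) + t * (a * y + \<phi> y)"
    using balance by (simp add: algebra_simps)
  also have "\<dots> = a * z + ((1 - t) * \<phi> x + t * \<phi> y)"
    by (simp add: z_def algebra_simps)
  finally show "ln (max_modulus f (exp ((1 - t) *\<^sub>R x + t *\<^sub>R y)))
      \<le> (1 - t) * ln (max_modulus f (exp x)) + t * ln (max_modulus f (exp y))"
    by (simp add: \<phi>_def z_def)
qed simp

section \<open>The characteristic \<open>K_char\<close> as the slope of a supporting line\<close>

text \<open>By the chain rule, \<open>r\<close> times the right derivative in \<open>r\<close> is
  the right derivative in \<open>ln r\<close>, which is the slope of a supporting line of the convex
  function from Hadamard's theorem.\<close>

lemma K_char_tangent:
  assumes hol: "f holomorphic_on ball 0 1" and nz: "\<exists>z\<in>ball 0 1. f z \<noteq> 0"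
    and r: "0 < r" "r < 1" and s: "0 < s" "s < 1"
  shows "ln (max_modulus f r) + K_char f r * (ln s - ln r) \<le> ln (max_modulus f s)"
proof -
  define \<phi> where "\<phi> u = ln (max_modulus f (exp u))" for u
  have "convex_on {..<0} \<phi>"
    using hadamard_three_circles[OF hol nz] by (simp add: \<phi>_def [abs_def])
  then obtain D where D: "(\<phi> has_real_derivative D) (at_right (ln r))"
    and tangent: "\<And>y. y \<in> {..<0} \<Longrightarrow> \<phi> (ln r) + D * (y - ln r) \<le> \<phi> y"
    using convex_on_has_right_derivative[of "{..<0}" \<phi> "ln r"] r
    by (metis interior_open lessThan_iff ln_less_zero open_lessThan)
  have "ln ` {r<..} \<subseteq> {ln r<..}" using r by auto
  then have "(\<phi> has_real_derivative D) (at (ln r) within ln ` {r<..})"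
    by (rule has_field_derivative_subset[OF D])
  moreover have "(ln has_real_derivative 1 / r) (at_right r)"
    using r by (auto intro!: derivative_eq_intros)
  ultimately have "(\<phi> \<circ> ln has_real_derivative D * (1 / r)) (at_right r)"
    by (rule DERIV_image_chain)
  then have "((\<lambda>t. ln (max_modulus f t)) has_real_derivative D * (1 / r)) (at_right r)"
    unfolding has_field_derivative_iff
  \<comment> \<open>\<open>exp (ln t) = t\<close> holds for positive \<open>t\<close> only, so the
    two functions are compared near \<open>r\<close> and not globally.\<close>
  proof (rule Lim_transform_eventually)
    show "\<forall>\<^sub>F t in at_right r. ((\<phi> \<circ> ln) t - (\<phi> \<circ> ln) r) / (t - r)
        = (ln (max_modulus f t) - ln (max_modulus f r)) / (t - r)"
      using eventually_at_right_less by eventually_elim (use r in \<open>simp add: \<phi>_def\<close>)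
  qed
  then have "vector_derivative (\<lambda>t. ln (max_modulus f t)) (at_right r) = D * (1 / r)"
    by (intro vector_derivative_within)
       (auto simp: has_real_derivative_iff_has_vector_derivative)
  then have "K_char f r = D" using r by (simp add: K_char_def)
  then show ?thesis using tangent[of "ln s"] r s by (simp add: \<phi>_def)
qed

text \<open>The supporting line at \<open>r\<close> cannot descend, since the maximum modulus
  increases. The sign allows \<open>K_char f r\<close> to be multiplied into upper bounds for
  \<open>ln s - ln r\<close>.\<close>

lemma K_char_nonneg:
  assumes hol: "f holomorphic_on ball 0 1" and nz: "\<exists>z\<in>ball 0 1. f z \<noteq> 0"
    and r: "0 < r" "r < 1"
  shows "0 \<le> K_char f r"
proof -
  have "ln (max_modulus f (r / 2)) \<le> ln (max_modulus f r)"
    using max_modulus_mono[OF hol, of "r / 2" r] max_modulus_pos[OF hol nz, of "r / 2"] r by simp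
  then have "K_char f r * (ln (r / 2) - ln r) \<le> 0"
    using K_char_tangent[OF hol nz r, of "r / 2"] r by simp
  then show ?thesis
    using r by (simp add: ln_div zero_le_mult_iff mult_le_0_iff)
qed

section \<open>Orders of growth\<close>

lemma log_plus_nonneg: "0 \<le> log_plus x"
  by (simp add: log_plus_def)

lemma ln_le_log_plus: "0 < x \<Longrightarrow> ln x \<le> log_plus x"
  by (simp add: log_plus_def)

lemma log_plus_eq_ln: "0 < log_plus x \<Longrightarrow> 0 < x \<and> log_plus x = ln x"
  by (auto simp: log_plus_def max_def split: if_splits)

lemma eventually_at_left_1: "\<forall>\<^sub>F r in at_left (1::real). 0 < r \<and> r < 1"
  using eventually_at_left_real[of 0 "1::real"] by simp

lemma Liminf_order_nonneg:
  "0 \<le> Liminf (at_left 1) (\<lambda>r. ereal (log_plus (g r) / ln (1 / (1 - r))))"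
proof (rule Liminf_bounded)
  show "\<forall>\<^sub>F r in at_left 1. 0 \<le> ereal (log_plus (g r) / ln (1 / (1 - r)))"
    using eventually_at_left_1
    by eventually_elim (auto intro!: divide_nonneg_nonneg simp: log_plus_nonneg)
qed

text \<open>The constant contributes \<open>ln C / ln (1 / (1 - r))\<close>, which tends to 0, so
  power bounds need to be known only up to a constant factor.\<close>

lemma le_Liminf_order:
  assumes C: "0 < C" and g: "\<forall>\<^sub>F r in at_left 1. C * (1 - r) powr (- p) \<le> g r"
  shows "ereal p \<le> Liminf (at_left 1) (\<lambda>r. ereal (log_plus (g r) / ln (1 / (1 - r))))"
proof -
  have "((\<lambda>r. (ln C - p * ln (1 - r)) / ln (1 / (1 - r))) \<longlongrightarrow> p) (at_left 1)"
    by real_asymp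
  then have "Liminf (at_left 1) (\<lambda>r. ereal ((ln C - p * ln (1 - r)) / ln (1 / (1 - r)))) = ereal p"
    by (intro lim_imp_Liminf) auto
  moreover have "Liminf (at_left 1) (\<lambda>r. ereal ((ln C - p * ln (1 - r)) / ln (1 / (1 - r))))
      \<le> Liminf (at_left 1) (\<lambda>r. ereal (log_plus (g r) / ln (1 / (1 - r))))"
  proof (rule Liminf_mono)
    show "\<forall>\<^sub>F r in at_left 1. ereal ((ln C - p * ln (1 - r)) / ln (1 / (1 - r)))
        \<le> ereal (log_plus (g r) / ln (1 / (1 - r)))"
      using g eventually_at_left_1
    proof eventually_elim
      case (elim r)
      have pos: "0 < C * (1 - r) powr (- p)" using C elim by simp
      have "ln C - p * ln (1 - r) = ln (C * (1 - r) powr (- p))"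
        using C elim by (simp add: ln_mult ln_powr)
      also have "\<dots> \<le> ln (g r)" using elim pos by (subst ln_le_cancel_iff) auto
      also have "\<dots> \<le> log_plus (g r)" using elim pos by (intro ln_le_log_plus) auto
      finally show ?case using elim by (auto intro!: divide_right_mono)
    qed
  qed
  ultimately show ?thesis by simp
qed

lemma less_Liminf_orderD:
  assumes p: "0 < p"
    and lim: "ereal p < Liminf (at_left 1) (\<lambda>r. ereal (log_plus (g r) / ln (1 / (1 - r))))"
  shows "\<forall>\<^sub>F r in at_left 1. (1 - r) powr (- p) < g r"
  using less_LiminfD[OF lim] eventually_at_left_1
proof eventually_elim
  case (elim r)
  have l: "0 < ln (1 / (1 - r))" using elim by simp
  have *: "p * ln (1 / (1 - r)) < log_plus (g r)"
    using elim l by (simp add: pos_less_divide_eq)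
  \<comment> \<open>Strict positivity excludes the truncated value 0, so \<open>log_plus\<close> is
    the true logarithm here.\<close>
  with p l have "0 < log_plus (g r)" by (smt (verit) mult_pos_pos)
  then have "0 < g r" "log_plus (g r) = ln (g r)" using log_plus_eq_ln by auto
  moreover have "(1 - r) powr (- p) = exp (p * ln (1 / (1 - r)))"
    using elim by (simp add: powr_def ln_div)
  ultimately show ?case using * by (metis exp_less_cancel_iff exp_ln)
qed

lemma Limsup_order_lessD:
  assumes p: "0 < p"
    and lim: "Limsup (at_left 1) (\<lambda>r. ereal (log_plus (g r) / ln (1 / (1 - r)))) < ereal p"
  shows "\<forall>\<^sub>F r in at_left 1. g r < (1 - r) powr (- p)"
  using Limsup_lessD[OF lim] eventually_at_left_1
proof eventually_elim
  case (elim r)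
  have l: "0 < ln (1 / (1 - r))" using elim by simp
  have *: "log_plus (g r) < p * ln (1 / (1 - r))"
    using elim l by (simp add: pos_divide_less_eq)
  have e: "(1 - r) powr (- p) = exp (p * ln (1 / (1 - r)))"
    using elim by (simp add: powr_def ln_div)
  show ?case
  proof (cases "0 < g r")
    case True
    then have "ln (g r) < p * ln (1 / (1 - r))" using * ln_le_log_plus[of "g r"] by simp
    then show ?thesis unfolding e using True by (metis exp_less_cancel_iff exp_ln)
  next
    case False
    then show ?thesis unfolding e by (smt (verit) exp_gt_zero)
  qed
qed

section \<open>Comparison of the orders\<close>

lemma lambda_star_le:
  assumes hol: "f holomorphic_on ball 0 1" and unb: "\<not> bounded (f ` ball 0 1)"
  shows "lambda_star f \<le> lambda_M f + 1"
proof (rule ccontr)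
  assume "\<not> lambda_star f \<le> lambda_M f + 1"
  \<comment> \<open>A real \<open>d\<close> strictly between the two sides exists even if
    \<open>lambda_star f\<close> is infinite, so no separate case is needed.\<close>
  then obtain d where d: "lambda_M f + 1 < ereal d" "ereal d < lambda_star f"
    using ereal_dense2 by (meson not_le)
  have "0 \<le> lambda_M f"
    unfolding lambda_M_def by (rule Liminf_order_nonneg)
  then have "0 + 1 \<le> lambda_M f + 1" by (rule add_right_mono)
  also note d(1)
  finally have d1: "1 < d" by (simp add: one_ereal_def)
  obtain z where z: "z \<in> ball 0 1" "1 < norm (f z)"
    using unb unfolding bounded_iff by (metis imageE not_le)
  then have nz: "\<exists>z\<in>ball 0 1. f z \<noteq> 0" by force
  have big: "\<forall>\<^sub>F r in at_left 1. 1 \<le> max_modulus f r"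
  proof -
    have "\<forall>\<^sub>F r in at_left 1. r \<in> {norm z<..<1}"
      using z by (intro eventually_at_left_real) simp
    then show ?thesis
    proof eventually_elim
      case (elim r)
    then show ?case using norm_le_max_modulus_cball[OF hol, of r z] z by simp
    qed
  qed
  have K: "\<forall>\<^sub>F r in at_left 1. (1 - r) powr (- d) < K_char f r"
    using d d1 unfolding lambda_star_def by (intro less_Liminf_orderD) auto
  \<comment> \<open>The inner radius is \<open>2 * R - 1\<close>, at twice the distance of
    \<open>R\<close> from 1; facts about radii near 1 transfer to it.\<close>
  have filt: "filterlim (\<lambda>R::real. 2 * R - 1) (at_left 1) (at_left 1)"
    by real_asymp
  have "\<forall>\<^sub>F R in at_left 1. 2 powr (- d) * (1 - R) powr (- (d - 1)) \<le> log_plus (max_modulus f R)"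
    using eventually_compose_filterlim[OF K filt] eventually_compose_filterlim[OF big filt]
      eventually_compose_filterlim[OF eventually_at_left_1 filt] eventually_at_left_1
  proof eventually_elim
    case (elim R)
    define r where "r = 2 * R - 1"
    have r: "0 < r" "r < 1" and R: "0 < R" "R < 1" using elim by (auto simp: r_def)
    have "2 powr (- d) * (1 - R) powr (- (d - 1)) = (1 - r) powr (- d) * (1 - R)"
    proof -
      have "(1 - r) powr (- d) = 2 powr (- d) * (1 - R) powr (- d)"
        using R by (simp add: r_def flip: powr_mult)
      moreover have "(1 - R) powr (- (d - 1)) = (1 - R) powr (- d) * (1 - R) powr 1"
        unfolding powr_add [symmetric] by (rule arg_cong) simp
      ultimately show ?thesis using R by simp
    qed
    also have "\<dots> \<le> K_char f r * (1 - R)"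
      using elim R by (intro mult_right_mono) (auto simp: r_def)
    \<comment> \<open>Since \<open>R - r = 1 - R\<close>, the bound \<open>ln x \<le> x - 1\<close>
      at \<open>x = r / R\<close> gives a logarithmic gap of at least \<open>1 - R\<close>.\<close>
    also have "\<dots> \<le> K_char f r * (ln R - ln r)"
    proof (rule mult_left_mono)
      have "ln (r / R) \<le> r / R - 1" using r R by (intro ln_le_minus_one) auto
      moreover have "r / R - 1 = - ((1 - R) / R)" using R by (simp add: r_def field_simps)
      moreover have "1 - R \<le> (1 - R) / R"
        using R mult_left_le[of R "1 - R"] by (simp add: pos_le_divide_eq)
      ultimately show "1 - R \<le> ln R - ln r" using r R by (simp add: ln_div)
    qed (rule K_char_nonneg[OF hol nz r])
    also have "\<dots> \<le> ln (max_modulus f R) - ln (max_modulus f r)"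
      using K_char_tangent[OF hol nz r R] by simp
    also have "\<dots> \<le> ln (max_modulus f R)"
      using elim by (simp add: r_def)
    also have "\<dots> \<le> log_plus (max_modulus f R)"
      using max_modulus_pos[OF hol nz R] by (rule ln_le_log_plus)
    finally show ?case .
  qed
  then have "ereal (d - 1) \<le> lambda_M f"
    unfolding lambda_M_def by (rule le_Liminf_order[rotated]) simp
  then have "ereal (d - 1) + 1 \<le> lambda_M f + 1" by (rule add_right_mono)
  then show False using d(1) by (simp add: one_ereal_def)
qed

text \<open>Exceeding a positive power of \<open>1 / (1 - r)\<close> puts the inner
  \<open>log_plus\<close> on its logarithmic branch. This forces a positive maximum modulus, which
  the zero function does not have.\<close>

lemma
  assumes a: "0 < a" "ereal a < lambda_M f"
  shows less_lambda_M_imp_nonzero: "\<exists>z\<in>ball 0 1. f z \<noteq> 0"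
    and less_lambda_M_D: "\<forall>\<^sub>F r in at_left 1. (1 - r) powr (- a) < ln (max_modulus f r)"
proof -
  have "\<forall>\<^sub>F r in at_left 1. (1 - r) powr (- a) < log_plus (max_modulus f r)"
    using a unfolding lambda_M_def by (intro less_Liminf_orderD)
  then have ev: "\<forall>\<^sub>F r in at_left 1. 0 < r \<and> r < 1 \<and> 0 < max_modulus f r \<and>
      (1 - r) powr (- a) < ln (max_modulus f r)"
    using eventually_at_left_1
  proof eventually_elim
    case (elim r)
    then have "0 < log_plus (max_modulus f r)" by (smt (verit) powr_ge_zero)
    from log_plus_eq_ln[OF this] elim show ?case by simp
  qed
  then show "\<forall>\<^sub>F r in at_left 1. (1 - r) powr (- a) < ln (max_modulus f r)"
    by (rule eventually_mono) simp
  obtain r where r: "0 < r" "r < 1" "0 < max_modulus f r"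
    using eventually_happens[OF ev] by auto
  show "\<exists>z\<in>ball 0 1. f z \<noteq> 0"
  proof (rule ccontr)
    assume *: "\<not> ?thesis"
    have "(\<lambda>z. norm (f z)) ` sphere 0 r = {0}"
    proof -
      have "sphere (0::complex) r \<noteq> {}" using r by simp
      moreover have "norm (f z) = 0" if "z \<in> sphere 0 r" for z using that r * by auto
      ultimately show ?thesis by (metis (no_types, lifting) image_cong image_constant_conv)
    qed
    then have "max_modulus f r = 0" by (simp add: max_modulus_def)
    with r show False by simp
  qed
qed

text \<open>The supporting line at \<open>r\<close> is compared with the fixed radius 1/2, whose
  value \<open>c\<close> is negligible against \<open>(1 - r) powr (- a)\<close>. This serves the
  case of infinite \<open>sigma_M f\<close>.\<close>

lemma lambda_M_le_lambda_star:
  assumes hol: "f holomorphic_on ball 0 1" and a: "0 < a" "ereal a < lambda_M f"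
  shows "ereal a \<le> lambda_star f"
proof -
  note nz = less_lambda_M_imp_nonzero[OF a]
  define c where "c = ln (max_modulus f (1/2))"
  have large: "\<forall>\<^sub>F r in at_left (1::real). 2 * c \<le> (1 - r) powr (- a)"
  proof -
    have "filterlim (\<lambda>r::real. (1 - r) powr (- a)) at_top (at_left 1)"
      using a by real_asymp
    then show ?thesis unfolding filterlim_at_top by blast
  qed
  have "\<forall>\<^sub>F r in at_left 1. 1/2 * (1 - r) powr (- a) \<le> K_char f r"
    using less_lambda_M_D[OF a] large eventually_at_left_1
  proof eventually_elim
    case (elim r)
    then have r: "0 < r" "r < 1" by auto
    have "1/2 * (1 - r) powr (- a) \<le> ln (max_modulus f r) - c"
      using elim by simp
    also have "\<dots> \<le> K_char f r * (ln r - ln (1/2))"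
      using K_char_tangent[OF hol nz r, of "1/2"] by (simp add: c_def algebra_simps)
    also have "\<dots> \<le> K_char f r * 1"
    proof (rule mult_left_mono)
      have "ln r \<le> 0" "ln (1/2 :: real) = - ln 2" "ln 2 \<le> (1::real)"
        using r ln_le_minus_one[of "2::real"] by (auto simp: ln_div)
      then show "ln r - ln (1/2) \<le> 1" by linarith
    qed (rule K_char_nonneg[OF hol nz r])
    finally show ?case by simp
  qed
  then show ?thesis
    unfolding lambda_star_def by (rule le_Liminf_order[rotated]) simp
qed

text \<open>The radius \<open>\<rho>\<close> is chosen so that \<open>(1 - \<rho>) powr (- s) = (1 - r) powr (- a) / 2\<close>: then the upper
  bound for \<open>ln (max_modulus f \<rho>)\<close> is at most half of the lower bound for \<open>ln (max_modulus f r)\<close>.\<close>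

lemma lambda_M_sigma_M_le_lambda_star:
  assumes hol: "f holomorphic_on ball 0 1" and a: "0 < a" "ereal a < lambda_M f"
    and s: "0 < s" "sigma_M f < ereal s"
  shows "ereal (a + a / s) \<le> lambda_star f"
proof -
  note nz = less_lambda_M_imp_nonzero[OF a]
  define \<rho> where "\<rho> r = 1 - 2 powr (1 / s) * (1 - r) powr (a / s)" for r
  have upper: "\<forall>\<^sub>F r in at_left 1. log_plus (max_modulus f r) < (1 - r) powr (- s)"
    using s unfolding sigma_M_def by (intro Limsup_order_lessD)
  have filt: "filterlim \<rho> (at_left 1) (at_left 1)"
  proof -
    have "0 < a / s" using a s by simp
    then show ?thesis unfolding \<rho>_def by real_asymp
  qed
  \<comment> \<open>Applied to \<open>\<rho> r\<close>, this gives \<open>1 / \<rho> r < 2\<close>,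
    the source of the factor 2 in the bound for \<open>ln r - ln (\<rho> r)\<close>.\<close>
  have half: "\<forall>\<^sub>F r in at_left (1::real). 1/2 < r \<and> r < 1"
    using eventually_at_left_real[of "1/2" "1::real"] by simp
  \<comment> \<open>One factor 1/2 comes from halving the lower bound, another from
    \<open>1 / \<rho> r < 2\<close>, and \<open>2 powr (1 / s)\<close> from the size of
    \<open>1 - \<rho> r\<close>.\<close>
  define C where "C = 1 / (4 * 2 powr (1 / s))"
  have "\<forall>\<^sub>F r in at_left 1. C * (1 - r) powr (- (a + a / s)) \<le> K_char f r"
    using less_lambda_M_D[OF a] eventually_at_left_1
      eventually_compose_filterlim[OF upper filt] eventually_compose_filterlim[OF half filt]
  proof eventually_elim
    case (elim r)
    then have r: "0 < r" "r < 1" and \<rho>: "1/2 < \<rho> r" "\<rho> r < 1" by auto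
    have gap: "1 - \<rho> r = 2 powr (1 / s) * (1 - r) powr (a / s)"
      by (simp add: \<rho>_def)
    have "(1 - \<rho> r) powr (- s) = 2 powr (- 1) * (1 - r) powr (- a)"
      using s unfolding gap by (simp add: powr_mult powr_powr)
    moreover have "ln (max_modulus f (\<rho> r)) \<le> log_plus (max_modulus f (\<rho> r))"
      using \<rho> by (intro ln_le_log_plus max_modulus_pos[OF hol nz]) auto
    ultimately have "1/2 * (1 - r) powr (- a) \<le> ln (max_modulus f r) - ln (max_modulus f (\<rho> r))"
      using elim by (simp add: powr_minus)
    also have "\<dots> \<le> K_char f r * (ln r - ln (\<rho> r))"
      using K_char_tangent[OF hol nz r, of "\<rho> r"] \<rho> by (simp add: algebra_simps)
    also have "\<dots> \<le> K_char f r * (2 * (1 - \<rho> r))"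
    proof (rule mult_left_mono)
      have "ln (1 / \<rho> r) \<le> 1 / \<rho> r - 1" using \<rho> by (intro ln_le_minus_one) auto
      moreover have "1 / \<rho> r - 1 = (1 - \<rho> r) / \<rho> r" using \<rho> by (simp add: field_simps)
      moreover have "(1 - \<rho> r) / \<rho> r \<le> (1 - \<rho> r) / (1/2)"
        using \<rho> by (intro divide_left_mono) auto
      moreover have "ln r \<le> 0" using r by simp
      ultimately show "ln r - ln (\<rho> r) \<le> 2 * (1 - \<rho> r)" using \<rho> by (simp add: ln_div)
    qed (rule K_char_nonneg[OF hol nz r])
    finally have *: "(1 - r) powr (- a) \<le> K_char f r * (4 * 2 powr (1 / s)) * (1 - r) powr (a / s)"
      by (simp add: gap algebra_simps)
    have "C * (1 - r) powr (- (a + a / s)) = C * ((1 - r) powr (- a) / (1 - r) powr (a / s))"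
      by (simp flip: powr_diff)
    also have "\<dots> \<le> C * (K_char f r * (4 * 2 powr (1 / s)))"
      using * r by (intro mult_left_mono) (auto simp: C_def pos_divide_le_eq)
    also have "\<dots> = K_char f r" by (simp add: C_def)
    finally show ?case .
  qed
  then show ?thesis
    unfolding lambda_star_def by (rule le_Liminf_order[rotated]) (simp add: C_def)
qed

lemma lambda_star_ge:
  assumes hol: "f holomorphic_on ball 0 1" and \<sigma>: "0 < sigma_M f"
  shows "lambda_M f + lambda_M f / sigma_M f \<le> lambda_star f"
proof -
  have lambda0: "0 \<le> lambda_M f" and star0: "0 \<le> lambda_star f"
    unfolding lambda_M_def lambda_star_def by (rule Liminf_order_nonneg)+
  have lambda_le_sigma: "lambda_M f \<le> sigma_M f"
    unfolding lambda_M_def sigma_M_def by (rule Liminf_le_Limsup) simp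
  \<comment> \<open>An infinite \<open>lambda_M f\<close> falls under the second case, because
    \<open>lambda_M f \<le> sigma_M f\<close>.\<close>
  consider "lambda_M f = 0" | "0 < lambda_M f" "sigma_M f = \<infinity>"
    | l \<sigma> where "lambda_M f = ereal l" "sigma_M f = ereal \<sigma>" "0 < l" "0 < \<sigma>"
    using lambda0 lambda_le_sigma \<sigma> by (cases "lambda_M f"; cases "sigma_M f") fastforce+
  then show ?thesis
  proof cases
    case 1
    then show ?thesis using star0 by simp
  next
    case 2
    have "lambda_M f \<le> lambda_star f"
    proof (rule ccontr)
      assume "\<not> ?thesis"
      then obtain a where a: "lambda_star f < ereal a" "ereal a < lambda_M f"
        using ereal_dense2 by (meson not_le)
      then have "0 < ereal a" using star0 by order
      then have "0 < a" by simp
      from lambda_M_le_lambda_star[OF hol this a(2)] a(1) show False by simp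
    qed
    then show ?thesis using 2 by (simp add: ereal_add_divide_infinity)
  next
    case 3
    \<comment> \<open>The single parameter \<open>t\<close> pushes \<open>a = t * l\<close> strictly
      below \<open>l\<close> and \<open>s = \<sigma> / t\<close> strictly above
      \<open>\<sigma>\<close>; letting \<open>t\<close> tend to 1 recovers both orders.\<close>
    have below: "ereal (t * l + t * l / (\<sigma> / t)) \<le> lambda_star f" if "t \<in> {0<..<1}" for t
      using that 3
      by (intro lambda_M_sigma_M_le_lambda_star[OF hol]) (auto simp: field_simps)
    have "((\<lambda>t. ereal (t * l + t * l / (\<sigma> / t))) \<longlongrightarrow> ereal (l + l / \<sigma>)) (at_left 1)"
      using 3 by (auto intro!: tendsto_eq_intros)
    moreover have "\<forall>\<^sub>F t in at_left (1::real). ereal (t * l + t * l / (\<sigma> / t)) \<le> lambda_star f"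
      using eventually_at_left_1 by eventually_elim (rule below, simp)
    ultimately have "ereal (l + l / \<sigma>) \<le> lambda_star f"
      by (rule tendsto_upperbound) simp
    then show ?thesis using 3 by simp
  qed
qed

theorem proposition8:
  fixes f :: "complex \<Rightarrow> complex"
  assumes "f analytic_on ball 0 1"
  shows "(\<not> bounded (f ` ball 0 1) \<longrightarrow> lambda_star f \<le> lambda_M f + 1) \<and>
         (sigma_M f > 0 \<longrightarrow> lambda_M f + lambda_M f / sigma_M f \<le> lambda_star f)"
  using lambda_star_le lambda_star_ge analytic_imp_holomorphic[OF assms] by blast

end
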